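(* Let $K\subset\mathbb{R}^2$ be a compact body and let $\mu$ be a measure on $(K,\mathcal{B}(K))$ with $\mu(K)<\infty$. Then the generalized conic function $F_{K,\mu}:\mathbb{R}^2\to[0,\infty)$ is a convex function which satisfies the growth condition $$\liminf_{\Vert(x,y)\Vert\to\infty}\frac{F_{K,\mu}(x,y)}{\sqrt{x^2+y^2}}\ge\mu(K)>0.$$ Consequently, the level sets of the function $F_{K,\mu}$ are bounded and hence compact subsets of $\mathbb{R}^2$.
   Context: A compact body in $\mathbb{R}^2$ is a non-empty compact set that coincides with the closure of its interior. $\mathcal{B}(K)$ is the Borel $\sigma$-algebra on $K$, and $\Vert\cdot\Vert$ is the Euclidean norm. The generalized conic function associated with $K$ and $\mu$ is $$F_{K,\mu}(x,y):=\int_K\big(|x-\alpha|+|y-\beta|\big)\,\mu(d\alpha,d\beta),\qquad (x,y)\in\mathbb{R}^2.$$ The level sets of $F_{K,\mu}$ are the sets $\{(x,y)\in\mathbb{R}^2:F_{K,\mu}(x,y)\le d\}$, $d\in[0,\infty)$.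
   Formalization: The claim μ(K)>0 fails for the zero measure (then F=0 and every level set is the whole plane), so μ(K)>0 is not concluded but assumed, and only for the boundedness and compactness of the level sets. *)

theory Defs
  imports "HOL-Analysis.Analysis"
begin

text \<open>The plane is \<^typ>\<open>real \<times> real\<close>, whose library norm is the Euclidean one.\<close>

definition compact_body :: "(real \<times> real) set \<Rightarrow> bool" where
  "compact_body K \<longleftrightarrow> K \<noteq> {} \<and> compact K \<and> K = closure (interior K)"

definition conic_integrand :: "real \<times> real \<Rightarrow> real \<times> real \<Rightarrow> real" where
  "conic_integrand = (\<lambda>(x, y) (\<alpha>, \<beta>). \<bar>x - \<alpha>\<bar> + \<bar>y - \<beta>\<bar>)"

text \<open>The Bochner integral is 0 for non-integrable integrands, so this is the intended
  function only where \<^const>\<open>conic_integrand\<close> is integrable.\<close>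

definition conic_function ::
  "(real \<times> real) set \<Rightarrow> (real \<times> real) measure \<Rightarrow> real \<times> real \<Rightarrow> real" where
  "conic_function K \<mu> p = (LINT q:K|\<mu>. conic_integrand p q)"

definition level_set :: "(real \<times> real \<Rightarrow> real) \<Rightarrow> real \<Rightarrow> (real \<times> real) set" where
  "level_set F d = {p. F p \<le> d}"

end

theory Submission
  imports Defs
begin

text \<open>
  The integrand is the taxicab distance of \<open>p\<close> and \<open>q\<close>. It is convex in \<open>p\<close>, and convexity passes
  to the integral over \<open>q\<close>. It is also at least the Euclidean distance, so if \<open>K\<close> lies in the ball
  of radius \<open>R\<close> about the origin, the triangle inequality gives
  \<open>conic_integrand p q \<ge> norm p - R\<close> for all \<open>q \<in> K\<close>. Integrating yields the affine minorant
  \<open>F p \<ge> \<mu>(K) * (norm p - R)\<close> (lemma \<open>conic_function_lower_bound\<close>), which carries both remaining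
  claims: divided by \<open>norm p\<close> it tends to \<open>\<mu>(K)\<close>, and for \<open>\<mu>(K) > 0\<close> it confines the level set of
  \<open>d\<close> to the ball of radius \<open>d / \<mu>(K) + R\<close>. Level sets are closed because a finite convex function
  on the plane is continuous.
\<close>

lemma conic_integrand_eq:
  "conic_integrand p q = \<bar>fst p - fst q\<bar> + \<bar>snd p - snd q\<bar>"
  by (simp add: conic_integrand_def split_beta)

lemma conic_integrand_nonneg: "0 \<le> conic_integrand p q"
  by (simp add: conic_integrand_eq)

lemma norm_diff_le_conic_integrand: "norm (p - q) \<le> conic_integrand p q"
  by (simp add: conic_integrand_eq norm_prod_def sqrt_sum_squares_le_sum_abs)

text \<open>
  A crude upper bound, used to dominate the integrand by a constant on a bounded set; the factor 2
  comes from estimating each coordinate difference by the full Euclidean distance.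
\<close>

lemma conic_integrand_le: "conic_integrand p q \<le> 2 * (norm p + norm q)"
proof -
  have "\<bar>fst p - fst q\<bar> \<le> norm (p - q)" "\<bar>snd p - snd q\<bar> \<le> norm (p - q)"
    using norm_fst_le[of "fst (p - q)" "snd (p - q)"] norm_snd_le[of "snd (p - q)" "fst (p - q)"]
    by (simp_all add: norm_prod_def)
  then show ?thesis
    using norm_triangle_ineq4[of p q] by (simp add: conic_integrand_eq)
qed

lemma continuous_on_conic_integrand: "continuous_on A (conic_integrand p)"
  unfolding conic_integrand_eq[abs_def] by (intro continuous_intros)

text \<open>
  Each summand is the absolute value of a linear functional shifted by a constant.
\<close>

lemma convex_on_conic_integrand: "convex_on UNIV (\<lambda>p. conic_integrand p q)"
proof -
  have abs: "convex_on UNIV (\<lambda>p. \<bar>g p - c\<bar>)"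
    if "linear g" for g :: "real \<times> real \<Rightarrow> real" and c
  proof (rule convex_onI)
    fix t :: real and x y assume t: "0 < t" "t < 1"
    have "g ((1 - t) *\<^sub>R x + t *\<^sub>R y) - c = (1 - t) * (g x - c) + t * (g y - c)"
      unfolding linear_add[OF that] linear_scale[OF that] by (simp add: algebra_simps)
    also have "\<bar>\<dots>\<bar> \<le> (1 - t) * \<bar>g x - c\<bar> + t * \<bar>g y - c\<bar>"
      using abs_triangle_ineq[of "(1 - t) * (g x - c)" "t * (g y - c)"] t by (simp add: abs_mult)
    finally show "\<bar>g ((1 - t) *\<^sub>R x + t *\<^sub>R y) - c\<bar> \<le> (1 - t) * \<bar>g x - c\<bar> + t * \<bar>g y - c\<bar>" .
  qed simp
  show ?thesis
    unfolding conic_integrand_eq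
    by (rule convex_on_add[OF abs[OF linear_fst] abs[OF linear_snd]])
qed

text \<open>
  The convexity inequality holds for each \<open>q \<in> A\<close> with the same weights, so it survives
  integration. Integrability is what makes the integral monotone and additive here: a
  non-integrable \<open>f p\<close> would have the default integral 0.
\<close>

lemma convex_on_set_integral:
  fixes f :: "'a::real_vector \<Rightarrow> 'b \<Rightarrow> real"
  assumes "convex S"
    and conv: "\<And>q. q \<in> A \<Longrightarrow> convex_on S (\<lambda>p. f p q)"
    and int: "\<And>p. p \<in> S \<Longrightarrow> set_integrable M A (f p)"
  shows "convex_on S (\<lambda>p. LINT q:A|M. f p q)"
proof (rule convex_onI)
  fix t x y assume t: "0 < t" "t < (1::real)" and xy: "x \<in> S" "y \<in> S"
  define z where "z = (1 - t) *\<^sub>R x + t *\<^sub>R y"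
  have "z \<in> S"
    using t xy \<open>convex S\<close> unfolding z_def by (simp add: convexD)
  have "(LINT q:A|M. f z q) \<le> (LINT q:A|M. (1 - t) * f x q + t * f y q)"
  proof (rule set_integral_mono)
    show "set_integrable M A (\<lambda>q. (1 - t) * f x q + t * f y q)"
      using int xy by (intro set_integral_add set_integrable_mult_right) auto
    show "f z q \<le> (1 - t) * f x q + t * f y q" if "q \<in> A" for q
      unfolding z_def using t xy by (intro convex_onD[OF conv[OF that]]) auto
  qed (rule int[OF \<open>z \<in> S\<close>])
  also have "\<dots> = (1 - t) * (LINT q:A|M. f x q) + t * (LINT q:A|M. f y q)"
    using int xy by (subst set_integral_add) auto
  finally show "(LINT q:A|M. f ((1 - t) *\<^sub>R x + t *\<^sub>R y) q)
      \<le> (1 - t) * (LINT q:A|M. f x q) + t * (LINT q:A|M. f y q)"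
    unfolding z_def .
qed fact

text \<open>
  Equality of the \<open>\<sigma>\<close>-algebras forces \<open>space \<mu> = K\<close>, so \<open>\<mu>\<close> is a finite measure, on
  which a bounded measurable function is integrable.
\<close>

lemma set_integrable_conic_integrand:
  assumes "bounded K"
    and sets: "sets \<mu> = sets (restrict_space borel K)"
    and fin: "emeasure \<mu> K < \<infinity>"
  shows "set_integrable \<mu> K (conic_integrand p)"
proof -
  have space: "space \<mu> = K"
    using sets_eq_imp_space_eq[OF sets] by (simp add: space_restrict_space)
  interpret finite_measure \<mu>
    by (rule finite_measureI) (use fin space in auto)
  obtain R where R: "norm q \<le> R" if "q \<in> K" for q
    using \<open>bounded K\<close> unfolding bounded_iff by blast
  have meas: "conic_integrand p \<in> borel_measurable \<mu>"
    by (subst measurable_cong_sets[OF sets refl])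
       (rule borel_measurable_continuous_on_restrict[OF continuous_on_conic_integrand])
  have "integrable \<mu> (conic_integrand p)"
  proof (rule integrable_const_bound[OF _ meas])
    show "AE q in \<mu>. norm (conic_integrand p q) \<le> 2 * (norm p + R)"
    proof (rule AE_I2)
      fix q assume "q \<in> space \<mu>"
      then show "norm (conic_integrand p q) \<le> 2 * (norm p + R)"
        using R[of q] conic_integrand_le[of p q] conic_integrand_nonneg[of p q] by (simp add: space)
    qed
  qed
  then show ?thesis
    using Bochner_Integration.integrable_cong[of \<mu> \<mu>
        "\<lambda>q. indicator K q *\<^sub>R conic_integrand p q" "conic_integrand p"]
    by (simp add: set_integrable_def space)
qed

lemma conic_function_nonneg: "0 \<le> conic_function K \<mu> p"
  unfolding conic_function_def set_lebesgue_integral_def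
  by (intro Bochner_Integration.integral_nonneg) (simp add: conic_integrand_nonneg)

text \<open>
  For \<open>q \<in> K\<close> the triangle inequality bounds the integrand below by the constant
  \<open>norm p - R\<close>, whose integral over \<open>K\<close> is the left-hand side.
\<close>

lemma conic_function_lower_bound:
  assumes sets: "K \<in> sets \<mu>" and fin: "emeasure \<mu> K < \<infinity>"
    and int: "set_integrable \<mu> K (conic_integrand p)"
    and R: "\<And>q. q \<in> K \<Longrightarrow> norm q \<le> R"
  shows "measure \<mu> K * (norm p - R) \<le> conic_function K \<mu> p"
proof -
  have "measure \<mu> K * (norm p - R) = (LINT q:K|\<mu>. norm p - R)"
    using sets fin by (simp add: set_lebesgue_integral_def)
  also have "\<dots> \<le> conic_function K \<mu> p"
    unfolding conic_function_def
  proof (rule set_integral_mono[OF _ int])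
    show "set_integrable \<mu> K (\<lambda>q. norm p - R)"
      using sets fin by (simp add: set_integrable_def)
    show "norm p - R \<le> conic_integrand p q" if "q \<in> K" for q
      using R[OF that] norm_diff_le_conic_integrand[of p q] norm_triangle_ineq2[of p q] by linarith
  qed
  finally show ?thesis .
qed

text \<open>
  After division by \<open>norm p\<close> the affine minorant becomes \<open>c - c * R / norm p\<close>, which tends to
  \<open>c\<close>.
\<close>

lemma Liminf_quotient_norm_ge:
  fixes f :: "'a::{real_normed_vector, perfect_space} \<Rightarrow> real"
  assumes "\<And>p. c * (norm p - R) \<le> f p"
  shows "ereal c \<le> Liminf at_infinity (\<lambda>p. ereal (f p / norm p))"
proof -
  have "((\<lambda>p::'a. c - c * R / norm p) \<longlongrightarrow> c - 0) at_infinity"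
    by (intro tendsto_diff tendsto_const
          tendsto_divide_0[OF tendsto_const]
          filterlim_at_top_imp_at_infinity filterlim_norm_at_top)
  then have "((\<lambda>p::'a. ereal (c - c * R / norm p)) \<longlongrightarrow> ereal c) at_infinity"
    by simp
  then have "ereal c = Liminf at_infinity (\<lambda>p::'a. ereal (c - c * R / norm p))"
    by (intro lim_imp_Liminf[symmetric]) (simp_all add: trivial_limit_at_infinity)
  also have "\<dots> \<le> Liminf at_infinity (\<lambda>p. ereal (f p / norm p))"
  proof (rule Liminf_mono)
    have "\<forall>\<^sub>F p::'a in at_infinity. 1 \<le> norm p"
      by (auto simp: eventually_at_infinity)
    then show "\<forall>\<^sub>F p in at_infinity. ereal (c - c * R / norm p) \<le> ereal (f p / norm p)"
    proof eventually_elim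
      case (elim p)
      then have "c - c * R / norm p = c * (norm p - R) / norm p"
        by (auto simp: right_diff_distrib diff_divide_distrib)
      also have "\<dots> \<le> f p / norm p"
        by (intro divide_right_mono assms) simp
      finally show ?case by simp
    qed
  qed
  finally show ?thesis .
qed

lemma bounded_level_set:
  assumes "\<And>p. c * (norm p - R) \<le> F p" and "0 < c"
  shows "bounded (level_set F d)"
proof (rule boundedI)
  fix p assume "p \<in> level_set F d"
  then have "c * (norm p - R) \<le> d"
    using assms(1)[of p] by (simp add: level_set_def)
  then show "norm p \<le> d / c + R"
    using \<open>0 < c\<close> by (simp add: field_simps)
qed

lemma closed_level_set:
  assumes "convex_on UNIV F"
  shows "closed (level_set F d)"
proof -
  have "continuous_on UNIV F"
    using assms by (intro convex_on_continuous) auto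
  then show ?thesis
    unfolding level_set_def by (intro closed_Collect_le continuous_on_const)
qed

theorem theorem2p1:
  fixes K :: "(real \<times> real) set" and \<mu> :: "(real \<times> real) measure"
  assumes "compact_body K"
    and "sets \<mu> = sets (restrict_space borel K)"
    and "emeasure \<mu> K < \<infinity>"
  shows "(\<forall>p. set_integrable \<mu> K (conic_integrand p) \<and> 0 \<le> conic_function K \<mu> p)
    \<and> convex_on UNIV (conic_function K \<mu>)
    \<and> Liminf at_infinity (\<lambda>(x, y). ereal (conic_function K \<mu> (x, y) / sqrt (x\<^sup>2 + y\<^sup>2)))
        \<ge> ereal (measure \<mu> K)
    \<and> (measure \<mu> K > 0 \<longrightarrow>
        (\<forall>d\<ge>0. bounded (level_set (conic_function K \<mu>) d)
              \<and> compact (level_set (conic_function K \<mu>) d)))"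
proof -
  have "bounded K"
    using assms(1) by (simp add: compact_body_def compact_imp_bounded)
  then obtain R where R: "norm q \<le> R" if "q \<in> K" for q
    unfolding bounded_iff by blast
  have "K \<in> sets \<mu>"
    using sets.top[of \<mu>] sets_eq_imp_space_eq[OF assms(2)] by (simp add: space_restrict_space)
  have int: "set_integrable \<mu> K (conic_integrand p)" for p
    by (rule set_integrable_conic_integrand[OF \<open>bounded K\<close> assms(2,3)])
  have conv: "convex_on UNIV (conic_function K \<mu>)"
    unfolding conic_function_def[abs_def]
    by (intro convex_on_set_integral convex_on_conic_integrand int) simp
  have lower: "measure \<mu> K * (norm p - R) \<le> conic_function K \<mu> p" for p
    by (rule conic_function_lower_bound[OF \<open>K \<in> sets \<mu>\<close> assms(3) int R])
  have quot: "(\<lambda>(x, y). ereal (conic_function K \<mu> (x, y) / sqrt (x\<^sup>2 + y\<^sup>2)))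
      = (\<lambda>p. ereal (conic_function K \<mu> p / norm p))"
    by (auto simp: norm_Pair)
  have bounded: "bounded (level_set (conic_function K \<mu>) d)" if "0 < measure \<mu> K" for d
    by (rule bounded_level_set[OF lower that])
  have closed: "closed (level_set (conic_function K \<mu>) d)" for d
    by (rule closed_level_set[OF conv])
  have growth: "ereal (measure \<mu> K)
      \<le> Liminf at_infinity (\<lambda>p. ereal (conic_function K \<mu> p / norm p))"
    by (rule Liminf_quotient_norm_ge[OF lower])
  show ?thesis
    unfolding quot compact_eq_bounded_closed
    by (simp add: int conic_function_nonneg conv growth bounded closed)
qed

end
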